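(* There exist constants $c_1,c_2,c_3>0$ and a family of DAGs $\{G_n=([n],E_n)\}_{n\ge2}$ with maximum indegree at most $2$ such that for every $n\ge 2$: the set $S=\{v\in[n]:\mathsf{parents}(v)=\emptyset\}$ of sources of $G_n$ satisfies $|S|\le c_1 n/\log n$, and for every complete legal parallel pebbling $P=(P_0,P_1,\ldots,P_t)$ of $G_n$ there is an interval $[i,j]\subseteq[t]$ such that (1) $\left|S\cap\left(\bigcup_{k=i}^{j}P_k\setminus P_{i-1}\right)\right|\ge c_2 n/\log n$, and (2) $|P_k|\ge c_3 n/\log n$ for every $k\in[i,j]$.
   Context: For a DAG $G=(V,E)$, a parallel pebbling of $G$ is a sequence $P=(P_0,P_1,\ldots,P_t)$ of subsets of $V$ with $P_0=\emptyset$; it is legal if for every $i\in[t]$ and every $x\in P_i\setminus P_{i-1}$ we have $\mathsf{parents}(x)\subseteq P_{i-1}$. It is complete if every sink of $G$ belongs to some $P_z$. Logarithms are base 2. *)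

theory Defs
  imports Complex_Main
begin

definition parents :: "('a \<times> 'a) set \<Rightarrow> 'a \<Rightarrow> 'a set" where
  "parents E v = {u. (u, v) \<in> E}"

definition is_dag :: "'a set \<Rightarrow> ('a \<times> 'a) set \<Rightarrow> bool" where
  "is_dag V E \<longleftrightarrow> finite V \<and> E \<subseteq> V \<times> V \<and> acyclic E"

definition max_indeg_le :: "'a set \<Rightarrow> ('a \<times> 'a) set \<Rightarrow> nat \<Rightarrow> bool" where
  "max_indeg_le V E d \<longleftrightarrow> (\<forall>v\<in>V. card (parents E v) \<le> d)"

definition sources :: "'a set \<Rightarrow> ('a \<times> 'a) set \<Rightarrow> 'a set" where
  "sources V E = {v\<in>V. parents E v = {}}"

definition sinks :: "'a set \<Rightarrow> ('a \<times> 'a) set \<Rightarrow> 'a set" where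
  "sinks V E = {v\<in>V. \<forall>w. (v, w) \<notin> E}"

text \<open>A parallel pebbling (P_0,...,P_t) is represented by a function P and a length t;
  only P 0 .. P t are relevant.\<close>

definition is_pebbling :: "'a set \<Rightarrow> (nat \<Rightarrow> 'a set) \<Rightarrow> nat \<Rightarrow> bool" where
  "is_pebbling V P t \<longleftrightarrow> P 0 = {} \<and> (\<forall>i\<le>t. P i \<subseteq> V)"

definition legal_pebbling :: "'a set \<Rightarrow> ('a \<times> 'a) set \<Rightarrow> (nat \<Rightarrow> 'a set) \<Rightarrow> nat \<Rightarrow> bool" where
  "legal_pebbling V E P t \<longleftrightarrow> is_pebbling V P t \<and>
     (\<forall>i\<in>{1..t}. \<forall>x \<in> P i - P (i - 1). parents E x \<subseteq> P (i - 1))"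

definition complete_pebbling :: "'a set \<Rightarrow> ('a \<times> 'a) set \<Rightarrow> (nat \<Rightarrow> 'a set) \<Rightarrow> nat \<Rightarrow> bool" where
  "complete_pebbling V E P t \<longleftrightarrow> (\<forall>s \<in> sinks V E. \<exists>z\<le>t. s \<in> P z)"

end

theory Submission
  imports Defs "HOL-Library.FuncSet"
begin

text \<open>The graphs follow the recursion of Paul, Tarjan and Celoni, with constant-degree dispersers
  (obtained by counting) in place of superconcentrators. A graph with \<open>N\<close> inputs and outputs is
  doubled by stacking two copies between \<open>2 * N\<close> new inputs and \<open>2 * N\<close> new outputs, so the graph
  with \<open>N = 2 ^ l\<close> has \<open>2 ^ l * (1 + 2 * l)\<close> vertices. Call a time low if fewer than \<open>N / 16\<close>
  vertices carry pebbles. If outputs are to be reached from a low time, then so are most outputs of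
  the second copy, and by induction there is an interval in which that copy holds \<open>N / 32\<close> pebbles
  while half of its inputs are pebbled. If much of this happens without a low time, then a maximal
  stretch without low times already pebbles most of the new inputs. Otherwise the interval contains
  a low time after which most outputs of the first copy must be pebbled afresh, and a second use of
  the induction gives a subinterval in which both copies hold \<open>N / 32\<close> pebbles each. Every stretch
  that starts with few pebbles and pebbles a constant fraction of a layer fed by the new inputs
  pebbles most of these inputs, so the input bound doubles along with the space bound.

  Replacing each vertex by a path of constant length brings the indegree down to two.\<close>

section \<open>Dispersers of constant degree\<close>

text \<open>The degree is 128 since each of the at least \<open>L / 16\<close> members of \<open>Y\<close> must contribute
  enough choices to beat the \<open>2 ^ (K + L) \<le> 8 ^ L\<close> pairs of sets in the union bound:
  \<open>8 * (3/4) ^ (128 / 16) < 1\<close>.\<close>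

definition disperser :: "nat \<Rightarrow> nat \<Rightarrow> (nat \<Rightarrow> nat list) \<Rightarrow> bool" where
  "disperser K L f \<longleftrightarrow> (\<forall>y<K. length (f y) = 128 \<and> set (f y) \<subseteq> {..<L}) \<and>
     (\<forall>Y\<subseteq>{..<K}. L \<le> 16 * card Y \<longrightarrow> 3 * L \<le> 4 * card (\<Union>y\<in>Y. set (f y)))"

text \<open>Counts the functions that confine the neighbours of \<open>Y\<close> to
  \<open>Z\<close>: each of the \<open>d * card Y\<close> list entries concerned costs a factor 3/4
  against the total \<open>L ^ (d * K)\<close>.\<close>

lemma card_confined_lists_le:
  fixes K L d :: nat
  assumes Y: "Y \<subseteq> {..<K}" and Z: "finite Z" "4 * card Z \<le> 3 * L"
  shows "real (card (\<Pi>\<^sub>E y\<in>{..<K}. {xs. set xs \<subseteq> (if y \<in> Y then Z else {..<L}) \<and> length xs = d}))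
    \<le> (3/4) ^ (d * card Y) * real (L ^ (d * K))"
proof -
  have "real (card (\<Pi>\<^sub>E y\<in>{..<K}. {xs. set xs \<subseteq> (if y \<in> Y then Z else {..<L}) \<and> length xs = d}))
      = (\<Prod>y<K. real (card (if y \<in> Y then Z else {..<L})) ^ d)"
    using Z by (simp add: card_PiE card_lists_length_eq)
  also have "\<dots> \<le> (\<Prod>y<K. (if y \<in> Y then (3/4) ^ d else 1) * real L ^ d)"
  proof (rule prod_mono)
    fix y assume "y \<in> {..<K}"
    have "real (card Z) ^ d \<le> (3/4 * real L) ^ d"
      using Z by (intro power_mono) auto
    then show "0 \<le> real (card (if y \<in> Y then Z else {..<L})) ^ d \<and>
      real (card (if y \<in> Y then Z else {..<L})) ^ d \<le> (if y \<in> Y then (3/4) ^ d else 1) * real L ^ d"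
      by (simp add: power_mult_distrib[symmetric])
  qed
  also have "\<dots> = (\<Prod>y<K. if y \<in> Y then (3/4) ^ d else 1) * (real L ^ d) ^ K"
    by (simp add: prod.distrib)
  also have "(\<Prod>y<K. if y \<in> Y then (3/4) ^ d else (1::real)) = (\<Prod>y\<in>Y. (3/4) ^ d)"
    using Y by (simp add: prod.If_cases Int_absorb1)
  finally show ?thesis
    by (simp add: power_mult)
qed

text \<open>A function that is no disperser confines some large \<open>Y\<close> to its own small
  neighbourhood. If none were a disperser, the sets \<open>bad p\<close> would cover all of
  \<open>F\<close>, but together they are too small.\<close>

lemma disperser_exists:
  fixes K L :: nat
  assumes "0 < L" and "K \<le> 2 * L"
  shows "\<exists>f. disperser K L f"
proof (rule ccontr)
  assume none: "\<nexists>f. disperser K L f"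
  define F where "F = (\<Pi>\<^sub>E y\<in>{..<K}. {xs. set xs \<subseteq> {..<L} \<and> length xs = 128})"
  define bad where "bad = (\<lambda>(Y, Z). \<Pi>\<^sub>E y\<in>{..<K}.
    {xs. set xs \<subseteq> (if y \<in> Y then Z else {..<L}) \<and> length xs = 128})"
  define I where "I = {(Y, Z). Y \<subseteq> {..<K} \<and> Z \<subseteq> {..<L} \<and> L \<le> 16 * card Y \<and> 4 * card Z < 3 * L}"
  have I_sub: "I \<subseteq> Pow {..<K} \<times> Pow {..<L}"
    by (auto simp: I_def)
  then have fin_I: "finite I"
    by (rule finite_subset) simp
  have "card I \<le> card (Pow {..<K} \<times> Pow {..<L})"
    using I_sub by (intro card_mono) auto
  also have "\<dots> = 2 ^ (K + L)"
    by (simp add: card_cartesian_product card_Pow power_add)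
  also have "\<dots> \<le> 2 ^ (3 * L)"
    using assms(2) by (intro power_increasing) auto
  finally have card_I: "card I \<le> 8 ^ L"
    by (simp add: power_mult)
  have fin_bad: "finite (bad p)" if "p \<in> I" for p
  proof -
    obtain Y Z where p: "p = (Y, Z)" "finite Z"
      using \<open>p \<in> I\<close> by (auto simp: I_def intro: finite_subset)
    then show ?thesis
      unfolding bad_def p(1) prod.case by (intro finite_PiE finite_lists_length_eq) auto
  qed
  have F_sub: "F \<subseteq> (\<Union>p\<in>I. bad p)"
  proof
    fix f assume f: "f \<in> F"
    then have "\<forall>y<K. length (f y) = 128 \<and> set (f y) \<subseteq> {..<L}"
      by (auto simp: F_def PiE_iff)
    with none obtain Y where Y: "Y \<subseteq> {..<K}" "L \<le> 16 * card Y"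
        "4 * card (\<Union>y\<in>Y. set (f y)) < 3 * L"
      unfolding disperser_def by (meson not_le)
    have "(Y, \<Union>y\<in>Y. set (f y)) \<in> I"
      using Y f by (fastforce simp: I_def F_def PiE_iff)
    moreover have "f \<in> bad (Y, \<Union>y\<in>Y. set (f y))"
      using f by (auto simp: bad_def F_def PiE_iff)
    ultimately show "f \<in> (\<Union>p\<in>I. bad p)" by blast
  qed
  have card_bad: "real (card (bad p)) \<le> (3/4) ^ (8 * L) * real (L ^ (128 * K))" if "p \<in> I" for p
  proof -
    obtain Y Z where p: "p = (Y, Z)" by (cases p)
    with that have YZ: "Y \<subseteq> {..<K}" "Z \<subseteq> {..<L}" "L \<le> 16 * card Y" "4 * card Z < 3 * L"
      by (auto simp: I_def)
    then have "real (card (bad p)) \<le> (3/4) ^ (128 * card Y) * real (L ^ (128 * K))"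
      unfolding p bad_def prod.case
      by (intro card_confined_lists_le) (auto intro: finite_subset)
    also have "(3/4::real) ^ (128 * card Y) \<le> (3/4) ^ (8 * L)"
      using YZ by (intro power_decreasing) auto
    finally show ?thesis
      by (simp add: mult_right_mono)
  qed
  have card_F: "card F = L ^ (128 * K)"
    by (simp add: F_def card_PiE card_lists_length_eq power_mult)
  have "card F \<le> card (\<Union>p\<in>I. bad p)"
    using F_sub fin_I fin_bad by (intro card_mono) auto
  also have "\<dots> \<le> (\<Sum>p\<in>I. card (bad p))"
    by (rule card_UN_le[OF fin_I])
  finally have "real (card F) \<le> (\<Sum>p\<in>I. real (card (bad p)))"
    by (metis of_nat_le_iff of_nat_sum)
  also have "\<dots> \<le> real (card I) * ((3/4) ^ (8 * L) * real (L ^ (128 * K)))"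
    using sum_bounded_above[of I, OF card_bad] by simp
  also have "\<dots> \<le> 8 ^ L * ((3/4) ^ (8 * L) * real (L ^ (128 * K)))"
    using card_I by (intro mult_right_mono) (auto simp flip: of_nat_le_iff)
  also have "\<dots> = (8 * (3/4) ^ 8) ^ L * real (card F)"
    by (simp only: card_F power_mult power_mult_distrib mult.assoc)
  also have "\<dots> < 1 * real (card F)"
  proof (rule mult_strict_right_mono)
    have "8 * (3/4::real) ^ 8 < 1"
      by (simp add: power_divide)
    then show "(8 * (3/4::real) ^ 8) ^ L < 1"
      using assms(1) by (intro power_Suc_less_one[THEN order.strict_trans2] power_less_one_iff[THEN iffD2]) auto
    show "0 < real (card F)"
      using assms(1) by (simp add: card_F)
  qed
  finally show False by simp
qed

section \<open>Traces, fresh vertices and hardness\<close>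

text \<open>\<^term>\<open>Q k\<close> are the vertices completed at time \<^term>\<open>k\<close>, and \<^term>\<open>X k\<close> those touched:
  a vertex will later be expanded into a path, which is completed when its end carries a pebble
  and touched when any of its vertices does.\<close>

definition trace :: "nat \<Rightarrow> (nat \<Rightarrow> nat list) \<Rightarrow> (nat \<Rightarrow> nat set) \<Rightarrow> (nat \<Rightarrow> nat set) \<Rightarrow> bool" where
  "trace M par Q X \<longleftrightarrow> (\<forall>k. Q k \<subseteq> X k \<and> X k \<subseteq> {..<M}) \<and>
     (\<forall>i j v u. i \<le> j \<longrightarrow> v \<in> Q j \<longrightarrow> v \<notin> X i \<longrightarrow> u \<in> set (par v) \<longrightarrow> (\<exists>k\<in>{i..j}. u \<in> Q k))"

text \<open>Everything touched at \<open>i\<close> is left out, not only what is completed then: a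
  path partly pebbled at \<open>i\<close> can be finished without pebbling all its parents
  again.\<close>

definition fresh :: "(nat \<Rightarrow> nat set) \<Rightarrow> (nat \<Rightarrow> nat set) \<Rightarrow> nat \<Rightarrow> nat \<Rightarrow> nat set" where
  "fresh Q X i j = (\<Union>k\<in>{i<..j}. Q k) - X i"

text \<open>Inputs are the first \<open>N\<close> vertices, outputs the last \<open>N\<close>. Only
  half of the outputs is demanded, because a disperser delivers three quarters of a layer less the
  pebbles present at the start.\<close>

definition hard :: "nat \<Rightarrow> nat \<Rightarrow> (nat \<Rightarrow> nat list) \<Rightarrow> bool" where
  "hard N M par \<longleftrightarrow> (\<forall>Q X s e. trace M par Q X \<longrightarrow> 16 * card (X s) \<le> N \<longrightarrow>
     N \<le> 2 * card (fresh Q X s e \<inter> {M - N..<M}) \<longrightarrow>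
     (\<exists>i j. s \<le> i \<and> i < j \<and> j \<le> e \<and> (\<forall>k\<in>{i<..j}. N \<le> 32 * card (X k)) \<and>
        N \<le> 2 * card (fresh Q X i j \<inter> {..<N})))"

lemma trace_finite:
  assumes "trace M par Q X"
  shows "finite (X k)" and "finite (fresh Q X i j)"
proof -
  show "finite (X k)" for k
    using assms finite_subset unfolding trace_def by blast
  then have "finite (Q k)" for k
    using assms finite_subset unfolding trace_def by blast
  then show "finite (fresh Q X i j)"
    by (auto simp: fresh_def)
qed

lemma parent_fresh:
  assumes "trace M par Q X" and "v \<in> fresh Q X i j" and "u \<in> set (par v)"
  shows "u \<in> fresh Q X i j \<union> X i"
proof -
  from assms(2) obtain k where k: "i < k" "k \<le> j" "v \<in> Q k" "v \<notin> X i"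
    by (auto simp: fresh_def)
  with assms obtain k' where k': "k' \<in> {i..k}" "u \<in> Q k'"
    unfolding trace_def by (meson less_imp_le)
  show ?thesis
  proof (cases "k' = i")
    case True
    then show ?thesis using assms(1) k' unfolding trace_def by blast
  next
    case False
    then show ?thesis using k k' by (auto simp: fresh_def)
  qed
qed

text \<open>A vertex completed after \<open>\<tau>\<close> is fresh from \<open>\<tau>\<close> on
  unless touched at \<open>\<tau>\<close>. The lemma serves to cut an interval at a low time, where
  \<open>card (X \<tau>)\<close> is small.\<close>

lemma card_fresh_split:
  assumes "trace M par Q X" and "\<tau> \<in> {i<..j}"
  shows "card (fresh Q X i j \<inter> S) \<le>
    card (fresh Q X i (\<tau> - 1) \<inter> S) + card (X \<tau>) + card (fresh Q X \<tau> j \<inter> S)"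
proof -
  note fin = trace_finite[OF assms(1)]
  have "v \<in> fresh Q X i (\<tau> - 1) \<or> v \<in> X \<tau> \<or> v \<in> fresh Q X \<tau> j" if v: "v \<in> fresh Q X i j" for v
  proof -
    from v obtain k where k: "i < k" "k \<le> j" "v \<in> Q k" "v \<notin> X i"
      by (auto simp: fresh_def)
    consider "k \<le> \<tau> - 1" | "k = \<tau>" | "\<tau> < k" using assms(2) by fastforce
    then show ?thesis
      using k assms(1) by cases (auto simp: fresh_def trace_def)
  qed
  then have "fresh Q X i j \<inter> S \<subseteq> fresh Q X i (\<tau> - 1) \<inter> S \<union> X \<tau> \<union> fresh Q X \<tau> j \<inter> S"
    by blast
  then have "card (fresh Q X i j \<inter> S) \<le> card (fresh Q X i (\<tau> - 1) \<inter> S \<union> X \<tau> \<union> fresh Q X \<tau> j \<inter> S)"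
    using fin by (intro card_mono) auto
  also have "\<dots> \<le> card (fresh Q X i (\<tau> - 1) \<inter> S) + card (X \<tau>) + card (fresh Q X \<tau> j \<inter> S)"
    by (meson add_le_mono1 card_Un_le order_trans)
  finally show ?thesis .
qed

text \<open>An earlier start loses only what is touched then, which is little if that time is
  low.\<close>

lemma card_fresh_extend:
  assumes "trace M par Q X" and "\<tau> \<le> i"
  shows "card (fresh Q X i j \<inter> S) \<le> card (fresh Q X \<tau> j \<inter> S) + card (X \<tau>)"
proof -
  note fin = trace_finite[OF assms(1)]
  have "fresh Q X i j \<inter> S \<subseteq> fresh Q X \<tau> j \<inter> S \<union> X \<tau>"
    using assms(2) by (fastforce simp: fresh_def)
  then have "card (fresh Q X i j \<inter> S) \<le> card (fresh Q X \<tau> j \<inter> S \<union> X \<tau>)"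
    using fin by (intro card_mono) auto
  also have "\<dots> \<le> card (fresh Q X \<tau> j \<inter> S) + card (X \<tau>)"
    by (rule card_Un_le)
  finally show ?thesis .
qed

text \<open>By \<open>parent_fresh\<close> the neighbours of the fresh vertices at \<open>q\<close>
  are fresh or touched at \<open>i\<close>, so the disperser forces three quarters of the layer at
  \<open>p\<close>. Having \<open>K' \<le> K\<close> lets half of a disperser serve the
  \<open>N\<close> inputs of a copy.\<close>

lemma card_fresh_disperser:
  assumes tr: "trace M par Q X" and disp: "disperser K L f" and "K' \<le> K"
    and edges: "\<And>x y. y < K' \<Longrightarrow> x \<in> set (f y) \<Longrightarrow> x + p \<in> set (par (y + q))"
    and large: "L \<le> 16 * card (fresh Q X i j \<inter> {q..<q + K'})"
  shows "3 * L \<le> 4 * (card (fresh Q X i j \<inter> {p..<p + L}) + card (X i))"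
proof -
  note fin = trace_finite[OF tr]
  define Y where "Y = {y. y < K' \<and> y + q \<in> fresh Q X i j}"
  have "(\<lambda>y. y + q) ` Y = fresh Q X i j \<inter> {q..<q + K'}"
  proof (intro equalityI subsetI)
    fix v assume "v \<in> fresh Q X i j \<inter> {q..<q + K'}"
    then show "v \<in> (\<lambda>y. y + q) ` Y"
      by (intro image_eqI[where x = "v - q"]) (auto simp: Y_def)
  qed (auto simp: Y_def)
  then have "card Y = card (fresh Q X i j \<inter> {q..<q + K'})"
    by (metis card_image inj_on_add')
  moreover have Y_sub: "Y \<subseteq> {..<K}"
    using \<open>K' \<le> K\<close> by (auto simp: Y_def)
  ultimately have "3 * L \<le> 4 * card (\<Union>y\<in>Y. set (f y))"
    using disp large unfolding disperser_def by metis
  also have "card (\<Union>y\<in>Y. set (f y)) = card ((\<lambda>x. x + p) ` (\<Union>y\<in>Y. set (f y)))"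
    by (simp add: card_image)
  also have "\<dots> \<le> card (fresh Q X i j \<inter> {p..<p + L} \<union> X i)"
  proof (rule card_mono)
    show "(\<lambda>x. x + p) ` (\<Union>y\<in>Y. set (f y)) \<subseteq> fresh Q X i j \<inter> {p..<p + L} \<union> X i"
    proof (clarify)
      fix x y assume y: "y \<in> Y" and x: "x \<in> set (f y)" and "x + p \<notin> X i"
      then have "x + p \<in> fresh Q X i j"
        using parent_fresh[OF tr, of "y + q" i j "x + p"] edges[of y x] by (auto simp: Y_def)
      moreover have "x < L"
        using disp y x Y_sub unfolding disperser_def by blast
      ultimately show "x + p \<in> fresh Q X i j \<inter> {p..<p + L}" by simp
    qed
  qed (use fin in auto)
  also have "\<dots> \<le> card (fresh Q X i j \<inter> {p..<p + L}) + card (X i)"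
    by (rule card_Un_le)
  finally show ?thesis by simp
qed

text \<open>Pulling \<open>Q\<close> and \<open>X\<close> back along the shift by \<open>p\<close>
  gives a trace of the copy, since additional parents only constrain the pebbling further. Space is
  counted inside the block so that the pebbles of two disjoint copies can later be added.\<close>

lemma hard_block:
  assumes hard: "hard N M par" and tr: "trace M' par' Q X" and "N \<le> M"
    and edges: "\<And>v u. v < M \<Longrightarrow> u \<in> set (par v) \<Longrightarrow> u < M \<and> u + p \<in> set (par' (v + p))"
    and few: "16 * card (X s) \<le> N"
    and large: "N \<le> 2 * card (fresh Q X s e \<inter> {p + M - N..<p + M})"
  obtains i j where "s \<le> i" "i < j" "j \<le> e"
    "\<And>k. k \<in> {i<..j} \<Longrightarrow> N \<le> 32 * card (X k \<inter> {p..<p + M})"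
    "N \<le> 2 * card (fresh Q X i j \<inter> {p..<p + N})"
proof -
  note fin = trace_finite[OF tr]
  define cut where "cut = (\<lambda>S. {v. v < M \<and> v + p \<in> S})"
  have card_cut: "card (cut S \<inter> {a..<b}) = card (S \<inter> {p + a..<p + b})" if "b \<le> M" for S a b
  proof -
    have "(\<lambda>v. v + p) ` (cut S \<inter> {a..<b}) = S \<inter> {p + a..<p + b}"
    proof (intro equalityI subsetI)
      fix v assume "v \<in> S \<inter> {p + a..<p + b}"
      then show "v \<in> (\<lambda>v. v + p) ` (cut S \<inter> {a..<b})"
        using that by (intro image_eqI[where x = "v - p"]) (auto simp: cut_def)
    qed (auto simp: cut_def)
    then show ?thesis by (metis card_image inj_on_add')
  qed
  have cut_X: "card (cut (X k)) = card (X k \<inter> {p..<p + M})" for k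
    using card_cut[of M "X k" 0] by (simp add: cut_def Int_def conj_commute)
  have fresh_cut: "fresh (\<lambda>k. cut (Q k)) (\<lambda>k. cut (X k)) i j = cut (fresh Q X i j)" for i j
    by (auto simp: fresh_def cut_def)
  have "trace M par (\<lambda>k. cut (Q k)) (\<lambda>k. cut (X k))"
    unfolding trace_def
  proof (intro conjI allI impI)
    fix k show "cut (Q k) \<subseteq> cut (X k)" "cut (X k) \<subseteq> {..<M}"
      using tr by (auto simp: trace_def cut_def)
  next
    fix i j v u assume *: "i \<le> j" "v \<in> cut (Q j)" "v \<notin> cut (X i)" "u \<in> set (par v)"
    then have v: "v < M" "v + p \<in> Q j" "v + p \<notin> X i" by (auto simp: cut_def)
    from edges[OF v(1) *(4)] have u: "u < M" "u + p \<in> set (par' (v + p))" by auto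
    with tr *(1) v obtain k where "k \<in> {i..j}" "u + p \<in> Q k"
      unfolding trace_def by meson
    with u show "\<exists>k\<in>{i..j}. u \<in> cut (Q k)" by (auto simp: cut_def)
  qed
  moreover have "16 * card (cut (X s)) \<le> N"
    using few card_mono[OF fin(1)[of s], of "X s \<inter> {p..<p + M}"] by (simp add: cut_X)
  moreover have "N \<le> 2 * card (cut (fresh Q X s e) \<inter> {M - N..<M})"
    using large \<open>N \<le> M\<close> by (simp add: card_cut)
  ultimately obtain i j where "s \<le> i" "i < j" "j \<le> e"
    "\<forall>k\<in>{i<..j}. N \<le> 32 * card (cut (X k))" "N \<le> 2 * card (cut (fresh Q X i j) \<inter> {..<N})"
    using hard unfolding hard_def fresh_cut[symmetric] by blast
  then show ?thesis
    using that card_cut[of N "fresh Q X i j" 0] \<open>N \<le> M\<close> by (simp add: cut_X atLeast0LessThan)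
qed

section \<open>The stacking construction\<close>

text \<open>The bound 256 leaves room for the lists of two dispersers. Parentless vertices being
  exactly the inputs makes the final digraph have \<open>N\<close> sources.\<close>

definition well_formed :: "nat \<Rightarrow> nat \<Rightarrow> (nat \<Rightarrow> nat list) \<Rightarrow> bool" where
  "well_formed N M par \<longleftrightarrow> N \<le> M \<and> (\<forall>v<M. (\<forall>u\<in>set (par v). u < v) \<and>
     (par v = [] \<longleftrightarrow> v < N) \<and> length (par v) \<le> 256)"

text \<open>The four consecutive blocks are \<open>2 * N\<close> new inputs, two copies of the given graph, and
  \<open>2 * N\<close> new outputs. The disperser \<open>A\<close> leads from the new inputs to the inputs of both copies
  and to the new outputs; \<open>B\<close> leads from the outputs of the first copy to the inputs of the
  second, and from the outputs of the second copy to the new outputs.\<close>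

definition stack ::
  "nat \<Rightarrow> nat \<Rightarrow> (nat \<Rightarrow> nat list) \<Rightarrow> (nat \<Rightarrow> nat list) \<Rightarrow> (nat \<Rightarrow> nat list) \<Rightarrow> nat \<Rightarrow> nat list" where
  "stack N M par A B v =
    (if v < 2 * N then []
     else if v < 2 * N + M then
       (let w = v - 2 * N in if w < N then A w else map (\<lambda>u. u + 2 * N) (par w))
     else if v < 2 * N + 2 * M then
       (let w = v - (2 * N + M) in
        if w < N then A w @ map (\<lambda>u. u + (N + M)) (B w) else map (\<lambda>u. u + (2 * N + M)) (par w))
     else (let w = v - (2 * N + 2 * M) in A w @ map (\<lambda>u. u + (N + 2 * M)) (B w)))"

lemma stack_first_copy:
  "w < M \<Longrightarrow> stack N M par A B (w + 2 * N) = (if w < N then A w else map (\<lambda>u. u + 2 * N) (par w))"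
  by (simp add: stack_def Let_def)

lemma stack_second_copy:
  "w < M \<Longrightarrow> stack N M par A B (w + (2 * N + M)) =
    (if w < N then A w @ map (\<lambda>u. u + (N + M)) (B w) else map (\<lambda>u. u + (2 * N + M)) (par w))"
  by (simp add: stack_def Let_def)

lemma stack_outputs:
  "stack N M par A B (w + (2 * N + 2 * M)) = A w @ map (\<lambda>u. u + (N + 2 * M)) (B w)"
  by (simp add: stack_def Let_def)

lemma stack_vertex_cases:
  fixes v N M :: nat
  assumes "v < 4 * N + 2 * M"
  obtains "v < 2 * N"
  | w where "w < M" "v = w + 2 * N"
  | w where "w < M" "v = w + (2 * N + M)"
  | w where "w < 2 * N" "v = w + (2 * N + 2 * M)"
proof -
  consider "v < 2 * N" | "2 * N \<le> v" "v < 2 * N + M" | "2 * N + M \<le> v" "v < 2 * N + 2 * M"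
    | "2 * N + 2 * M \<le> v" by linarith
  then show thesis
  proof cases
    case 1 then show thesis by (rule that(1))
  next
    case 2 then show thesis by (intro that(2)[of "v - 2 * N"]) auto
  next
    case 3 then show thesis by (intro that(3)[of "v - (2 * N + M)"]) auto
  next
    case 4 then show thesis using assms by (intro that(4)[of "v - (2 * N + 2 * M)"]) auto
  qed
qed

lemma well_formed_stack:
  assumes wf: "well_formed N M par" and A: "disperser (2 * N) (2 * N) A" and B: "disperser (2 * N) N B"
  shows "well_formed (2 * N) (4 * N + 2 * M) (stack N M par A B)"
  unfolding well_formed_def
proof (intro conjI allI impI)
  have NM: "N \<le> M" using wf by (simp add: well_formed_def)
  have lenA: "length (A w) = 128" "A w \<noteq> []" if "w < 2 * N" for w
    using A that by (auto simp: disperser_def)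
  have lenB: "length (B w) = 128" if "w < 2 * N" for w
    using B that by (auto simp: disperser_def)
  have setA: "u < 2 * N" if "w < 2 * N" "u \<in> set (A w)" for w u
    using A that by (auto simp: disperser_def)
  have setB: "u < N" if "w < 2 * N" "u \<in> set (B w)" for w u
    using B that by (auto simp: disperser_def)
  have par: "u < w" if "w < M" "u \<in> set (par w)" for w u
    using wf that by (auto simp: well_formed_def)
  have par_len: "length (par w) \<le> 256" if "w < M" for w
    using wf that by (auto simp: well_formed_def)
  have par_Nil: "par w = [] \<longleftrightarrow> w < N" if "w < M" for w
    using wf that by (auto simp: well_formed_def)
  show "2 * N \<le> 4 * N + 2 * M" by simp
  fix v assume "v < 4 * N + 2 * M"
  then have "(\<forall>u\<in>set (stack N M par A B v). u < v) \<and>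
    (stack N M par A B v = [] \<longleftrightarrow> v < 2 * N) \<and> length (stack N M par A B v) \<le> 256"
  proof (cases rule: stack_vertex_cases)
    case 1
    then show ?thesis by (simp add: stack_def)
  next
    case (2 w)
    then show ?thesis
      using setA[of w] par[of w] lenA[of w] par_len[of w] par_Nil[of w]
      by (auto simp: stack_first_copy trans_less_add2)
  next
    case (3 w)
    then show ?thesis
      using setA[of w] setB[of w] par[of w] lenA[of w] lenB[of w] par_len[of w] par_Nil[of w] NM
      by (fastforce simp: stack_second_copy)
  next
    case (4 w)
    then show ?thesis
      using setA[of w] setB[of w] lenA[of w] lenB[of w] NM
      by (fastforce simp: stack_outputs)
  qed
  then show "\<forall>u\<in>set (stack N M par A B v). u < v"
    "stack N M par A B v = [] \<longleftrightarrow> v < 2 * N" "length (stack N M par A B v) \<le> 256"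
    by auto
qed

section \<open>Hardness by induction on the level\<close>

lemma last_time_before:
  fixes P :: "nat \<Rightarrow> bool"
  assumes "P t" and "t \<le> i"
  obtains \<tau> where "t \<le> \<tau>" "\<tau> \<le> i" "P \<tau>" "\<And>k. k \<in> {\<tau><..i} \<Longrightarrow> \<not> P k"
proof -
  define \<tau> where "\<tau> = (GREATEST k. k \<le> i \<and> P k)"
  have "\<tau> \<le> i \<and> P \<tau>"
    unfolding \<tau>_def by (rule GreatestI_nat[where b = i and k = t]) (use assms in auto)
  moreover have "k \<le> \<tau>" if "k \<le> i" "P k" for k
    unfolding \<tau>_def by (rule Greatest_le_nat[where b = i]) (use that in auto)
  ultimately show thesis
    using assms by (intro that[of \<tau>]) (fastforce simp: not_le)+
qed

lemma first_time_after:
  fixes P :: "nat \<Rightarrow> bool"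
  obtains "\<And>k. k \<in> {i<..j} \<Longrightarrow> \<not> P k"
  | \<tau> where "\<tau> \<in> {i<..j}" "P \<tau>" "\<And>k. k \<in> {i<..\<tau> - 1} \<Longrightarrow> \<not> P k"
proof (cases "\<exists>k\<in>{i<..j}. P k")
  case False
  then show thesis using that(1) by blast
next
  case True
  define \<tau> where "\<tau> = (LEAST k. k \<in> {i<..j} \<and> P k)"
  from True obtain k0 where "k0 \<in> {i<..j} \<and> P k0" by blast
  then have \<tau>: "\<tau> \<in> {i<..j} \<and> P \<tau>"
    unfolding \<tau>_def by (rule LeastI)
  have "\<not> P k" if "k \<in> {i<..\<tau> - 1}" for k
  proof -
    have "k < \<tau>" "k \<in> {i<..j}" using that \<tau> by auto
    then show ?thesis
      using not_less_Least[of k "\<lambda>k. k \<in> {i<..j} \<and> P k", folded \<tau>_def] by blast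
  qed
  with \<tau> show thesis using that(2) by blast
qed

lemma hard_stack:
  assumes hard: "hard N M par" and wf: "well_formed N M par" and N: "0 < N"
    and A: "disperser (2 * N) (2 * N) A" and B: "disperser (2 * N) N B"
  shows "hard (2 * N) (4 * N + 2 * M) (stack N M par A B)"
  unfolding hard_def
proof (intro allI impI)
  fix Q X s e
  define I2 Out where "I2 = {2 * N + M..<2 * N + M + N}" and "Out = {2 * N + 2 * M..<2 * N + 2 * M + 2 * N}"
  assume tr: "trace (4 * N + 2 * M) (stack N M par A B) Q X"
    and few: "16 * card (X s) \<le> 2 * N"
    and "2 * N \<le> 2 * card (fresh Q X s e \<inter> {4 * N + 2 * M - 2 * N..<4 * N + 2 * M})"
  then have large: "N \<le> card (fresh Q X s e \<inter> Out)"
    by (simp add: Out_def add.commute)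
  let ?goal = "\<exists>i j. s \<le> i \<and> i < j \<and> j \<le> e \<and> (\<forall>k\<in>{i<..j}. 2 * N \<le> 32 * card (X k)) \<and>
    2 * N \<le> 2 * card (fresh Q X i j \<inter> {..<2 * N})"
  note fin = trace_finite[OF tr]
  have NM: "N \<le> M" and par_lt: "\<And>v u. v < M \<Longrightarrow> u \<in> set (par v) \<Longrightarrow> u < M"
    and par_Nil: "\<And>v. v < N \<Longrightarrow> par v = []"
    using wf by (auto simp: well_formed_def intro: less_trans)
  \<comment> \<open>The threshold serves twice: a time that is not low meets the space bound for
    \<open>2 * N\<close>, and a low time meets the start condition for \<open>N\<close>.\<close>
  define low where "low = (\<lambda>k. 16 * card (X k) < N)"

  \<comment> \<open>A stretch without low times that starts from few pebbles and reaches \<open>N/8\<close> vertices of one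
    of the layers fed by \<open>A\<close> also reaches half of the inputs.\<close>
  have finish: ?goal
    if "s \<le> i" "j \<le> e" and high: "\<And>k. k \<in> {i<..j} \<Longrightarrow> \<not> low k" and "8 * card (X i) \<le> N"
      and "K \<le> 2 * N" and edges: "\<And>y x. y < K \<Longrightarrow> x \<in> set (A y) \<Longrightarrow> x \<in> set (stack N M par A B (y + q))"
      and lg: "N \<le> 8 * card (fresh Q X i j \<inter> {q..<q + K})" for i j q K
  proof -
    have "3 * (2 * N) \<le> 4 * (card (fresh Q X i j \<inter> {0..<0 + 2 * N}) + card (X i))"
      using edges lg by (intro card_fresh_disperser[OF tr A \<open>K \<le> 2 * N\<close>, where q = q]) auto
    \<comment> \<open>At least \<open>3N/2 - N/8\<close> inputs are fresh, more than the
      \<open>N\<close> required.\<close>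
    then have "2 * N \<le> 2 * card (fresh Q X i j \<inter> {..<2 * N})"
      using \<open>8 * card (X i) \<le> N\<close> by (simp add: atLeast0LessThan)
    moreover have "i < j"
    proof (rule ccontr)
      assume "\<not> i < j"
      then have "fresh Q X i j = {}" by (simp add: fresh_def)
      with lg N show False by simp
    qed
    moreover have "\<forall>k\<in>{i<..j}. 2 * N \<le> 32 * card (X k)"
      using high unfolding low_def by fastforce
    ultimately show ?goal
      using that(1,2) by blast
  qed
  have finish_out: ?goal
    if "s \<le> i" "j \<le> e" "\<And>k. k \<in> {i<..j} \<Longrightarrow> \<not> low k" "8 * card (X i) \<le> N"
      "N \<le> 8 * card (fresh Q X i j \<inter> Out)" for i j
    using that by (intro finish[of i j "2 * N" "2 * N + 2 * M"]) (auto simp: stack_outputs Out_def)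
  have finish_second: ?goal
    if "s \<le> i" "j \<le> e" "\<And>k. k \<in> {i<..j} \<Longrightarrow> \<not> low k" "8 * card (X i) \<le> N"
      "N \<le> 8 * card (fresh Q X i j \<inter> I2)" for i j
    using that NM by (intro finish[of i j N "2 * N + M"]) (auto simp: stack_second_copy I2_def)
  have finish_first: ?goal
    if "s \<le> i" "j \<le> e" "\<And>k. k \<in> {i<..j} \<Longrightarrow> \<not> low k" "8 * card (X i) \<le> N"
      "N \<le> 8 * card (fresh Q X i j \<inter> {2 * N..<2 * N + N})" for i j
    using that NM by (intro finish[of i j N "2 * N"]) (auto simp: stack_first_copy)

  \<comment> \<open>After the first low time many outputs remain, since otherwise the initial stretch finishes.\<close>
  have "?goal \<or> (\<exists>t\<ge>s. low t \<and> N \<le> 2 * card (fresh Q X t e \<inter> Out))"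
  proof (cases "low s")
    case True
    then show ?thesis using large by (intro disjI2 exI[of _ s]) simp
  next
    case False
    show ?thesis
    proof (cases rule: first_time_after[of s e low])
      case 1
      then show ?thesis using large few by (intro disjI1 finish_out[of s e]) auto
    next
      case (2 \<tau>)
      show ?thesis
      proof (cases "N \<le> 8 * card (fresh Q X s (\<tau> - 1) \<inter> Out)")
        case True
        then show ?thesis using 2 few by (intro disjI1 finish_out[of s "\<tau> - 1"]) auto
      next
        case False
        \<comment> \<open>Of \<open>N\<close> outputs, fewer than \<open>N/8\<close> are fresh
          before \<open>\<tau>\<close> and fewer than \<open>N/16\<close> touched at
          \<open>\<tau>\<close>.\<close>
        then have "N \<le> 2 * card (fresh Q X \<tau> e \<inter> Out)"
          using card_fresh_split[OF tr 2(1), of Out] large 2(2) unfolding low_def by linarith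
        then show ?thesis using 2 by (intro disjI2 exI[of _ \<tau>]) auto
      qed
    qed
  qed
  then show ?goal
  proof
    assume "\<exists>t\<ge>s. low t \<and> N \<le> 2 * card (fresh Q X t e \<inter> Out)"
    then obtain t where t: "s \<le> t" "low t" "N \<le> 2 * card (fresh Q X t e \<inter> Out)" by blast
    have "3 * N \<le> 4 * (card (fresh Q X t e \<inter> {N + 2 * M..<N + 2 * M + N}) + card (X t))"
      using t(3) by (intro card_fresh_disperser[OF tr B order_refl, where q = "2 * N + 2 * M"])
        (auto simp: stack_outputs Out_def)
    \<comment> \<open>\<open>3N/4\<close> less the fewer than \<open>N/16\<close> vertices touched
      at \<open>t\<close> exceeds \<open>N/2\<close>, as \<open>hard\<close> demands of the second
      copy.\<close>
    then have out2: "N \<le> 2 * card (fresh Q X t e \<inter> {2 * N + M + M - N..<2 * N + M + M})"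
      using t(2) by (simp add: low_def mult_2 add.commute add.left_commute)
    obtain i j where ij: "t \<le> i" "i < j" "j \<le> e"
      and high2: "\<And>k. k \<in> {i<..j} \<Longrightarrow> N \<le> 32 * card (X k \<inter> {2 * N + M..<2 * N + M + M})"
      and in2: "N \<le> 2 * card (fresh Q X i j \<inter> I2)"
    proof (rule hard_block[OF hard tr NM _ _ out2])
      show "u < M \<and> u + (2 * N + M) \<in> set (stack N M par A B (v + (2 * N + M)))"
        if "v < M" "u \<in> set (par v)" for v u
        using that par_lt par_Nil[of v] by (cases "v < N") (auto simp: stack_second_copy)
    qed (use t(2) in \<open>auto simp: low_def I2_def\<close>)
    \<comment> \<open>The interval given by the induction hypothesis may start with many pebbles.
      Moving its start back to the last low time leaves few pebbles there and adds no low time after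
      it.\<close>
    obtain \<tau>0 where \<tau>0: "t \<le> \<tau>0" "\<tau>0 \<le> i" "low \<tau>0" "\<And>k. k \<in> {\<tau>0<..i} \<Longrightarrow> \<not> low k"
      using last_time_before[of low t i] t(2) ij(1) by blast
    \<comment> \<open>Moving the start to \<open>\<tau>0\<close> loses fewer than
      \<open>N/16\<close> of these \<open>N/4\<close> inputs, which leaves the \<open>N/8\<close>
      that \<open>finish_second\<close> needs.\<close>
    have finish_back: ?goal
      if "j' \<le> j" and high: "\<And>k. k \<in> {i<..j'} \<Longrightarrow> \<not> low k" and in2': "N \<le> 4 * card (fresh Q X i j' \<inter> I2)" for j'
    proof (rule finish_second[of \<tau>0 j'])
      show "\<not> low k" if "k \<in> {\<tau>0<..j'}" for k
        using \<tau>0(4)[of k] high[of k] that by fastforce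
      show "N \<le> 8 * card (fresh Q X \<tau>0 j' \<inter> I2)"
        using card_fresh_extend[OF tr \<tau>0(2), of j' I2] in2' \<tau>0(3) unfolding low_def by linarith
    qed (use t \<tau>0 ij \<open>j' \<le> j\<close> in \<open>auto simp: low_def\<close>)
    show ?goal
    proof (cases rule: first_time_after[of i j low])
      case 1
      then show ?goal using in2 by (intro finish_back[of j]) auto
    next
      case (2 \<tau>)
      show ?goal
      proof (cases "N \<le> 4 * card (fresh Q X i (\<tau> - 1) \<inter> I2)")
        case True
        then show ?goal using 2 by (intro finish_back[of "\<tau> - 1"]) auto
      next
        case False
        \<comment> \<open>\<open>N/2\<close> less \<open>N/4\<close> and \<open>N/16\<close> leaves
          \<open>3N/16\<close>, while \<open>B\<close> needs only \<open>N/16\<close> inputs of the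
          second copy to force most outputs of the first.\<close>
        then have "N \<le> 16 * card (fresh Q X \<tau> j \<inter> I2)"
          using card_fresh_split[OF tr 2(1), of I2] in2 2(2) unfolding low_def by linarith
        then have "3 * N \<le> 4 * (card (fresh Q X \<tau> j \<inter> {N + M..<N + M + N}) + card (X \<tau>))"
          using NM by (intro card_fresh_disperser[OF tr B, where q = "2 * N + M" and K' = N])
            (auto simp: stack_second_copy I2_def)
        then have out1: "N \<le> 2 * card (fresh Q X \<tau> j \<inter> {2 * N + M - N..<2 * N + M})"
          using 2(2) by (simp add: low_def mult_2 add.commute add.left_commute)
        obtain i1 j1 where ij1: "\<tau> \<le> i1" "i1 < j1" "j1 \<le> j"
          and high1: "\<And>k. k \<in> {i1<..j1} \<Longrightarrow> N \<le> 32 * card (X k \<inter> {2 * N..<2 * N + M})"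
          and in1: "N \<le> 2 * card (fresh Q X i1 j1 \<inter> {2 * N..<2 * N + N})"
        proof (rule hard_block[OF hard tr NM _ _ out1])
          show "u < M \<and> u + 2 * N \<in> set (stack N M par A B (v + 2 * N))"
            if "v < M" "u \<in> set (par v)" for v u
            using that par_lt par_Nil[of v] by (cases "v < N") (auto simp: stack_first_copy)
        qed (use 2(2) in \<open>auto simp: low_def\<close>)
        \<comment> \<open>The same step back as for \<open>\<tau>0\<close>; a low time to stop at
          exists because \<open>\<tau>\<close> is low.\<close>
        obtain \<tau>1 where \<tau>1: "\<tau> \<le> \<tau>1" "\<tau>1 \<le> i1" "low \<tau>1" "\<And>k. k \<in> {\<tau>1<..i1} \<Longrightarrow> \<not> low k"
          using last_time_before[of low \<tau> i1] 2(2) ij1(1) by blast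
        show ?goal
        proof (rule finish_first[of \<tau>1 j1])
          \<comment> \<open>Both copies are heavily pebbled here, which doubles the space bound.\<close>
          have "\<not> low k" if "k \<in> {i1<..j1}" for k
          proof -
            have avg: "N \<le> 16 * (a + b)" if "N \<le> 32 * a" "N \<le> 32 * b" for a b :: nat
              using that by (cases "a \<le> b") auto
            have k: "k \<in> {i<..j}" using that ij1 2(1) by auto
            have "N \<le> 16 * (card (X k \<inter> {2 * N..<2 * N + M}) +
              card (X k \<inter> {2 * N + M..<2 * N + M + M}))"
              by (rule avg[OF high1[OF that] high2[OF k]])
            also have "card (X k \<inter> {2 * N..<2 * N + M}) + card (X k \<inter> {2 * N + M..<2 * N + M + M})
              = card (X k \<inter> {2 * N..<2 * N + M} \<union> X k \<inter> {2 * N + M..<2 * N + M + M})"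
              using fin by (intro card_Un_disjoint[symmetric]) auto
            also have "\<dots> \<le> card (X k)"
              using fin by (intro card_mono) auto
            finally show ?thesis by (simp add: low_def)
          qed
          then show "\<not> low k" if "k \<in> {\<tau>1<..j1}" for k
            using \<tau>1(4)[of k] that by (cases "k \<le> i1") auto
          show "N \<le> 8 * card (fresh Q X \<tau>1 j1 \<inter> {2 * N..<2 * N + N})"
            using card_fresh_extend[OF tr \<tau>1(2), of j1 "{2 * N..<2 * N + N}"] in1 \<tau>1(3)
            unfolding low_def by linarith
        qed (use t ij 2 ij1 \<tau>1 in \<open>auto simp: low_def\<close>)
      qed
    qed
  qed
qed

text \<open>The interval runs from the last untouched time before the first completion up to that
  completion: the vertex is fresh over it and touched throughout.\<close>

lemma hard_singleton: "hard 1 1 (\<lambda>_. [])"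
  unfolding hard_def
proof (intro allI impI)
  fix Q X s e
  assume tr: "trace 1 (\<lambda>_. []) Q X" and "16 * card (X s) \<le> 1"
    and "1 \<le> 2 * card (fresh Q X s e \<inter> {1 - 1..<1})"
  then have "fresh Q X s e \<inter> {0..<1} \<noteq> {}" by (metis card.empty diff_self_eq_0 mult_0_right not_one_le_zero)
  then have 0: "0 \<in> fresh Q X s e" by auto
  have X: "X k \<subseteq> {0}" "Q k \<subseteq> X k" for k
    using tr by (auto simp: trace_def)
  show "\<exists>i j. s \<le> i \<and> i < j \<and> j \<le> e \<and> (\<forall>k\<in>{i<..j}. 1 \<le> 32 * card (X k)) \<and>
      1 \<le> 2 * card (fresh Q X i j \<inter> {..<1})"
  proof (cases rule: first_time_after[of s e "\<lambda>k. 0 \<in> Q k"])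
    case 1
    with 0 show ?thesis by (auto simp: fresh_def)
  next
    case (2 \<tau>)
    obtain \<sigma> where \<sigma>: "s \<le> \<sigma>" "\<sigma> \<le> \<tau> - 1" "0 \<notin> X \<sigma>" "\<And>k. k \<in> {\<sigma><..\<tau> - 1} \<Longrightarrow> 0 \<in> X k"
    proof (rule last_time_before[of "\<lambda>k. 0 \<notin> X k" s "\<tau> - 1"])
      show "0 \<notin> X s" "s \<le> \<tau> - 1" using 0 2(1) by (auto simp: fresh_def)
    qed auto
    have "0 \<in> X k" if "k \<in> {\<sigma><..\<tau>}" for k
      using \<sigma>(4)[of k] 2(2) X(2)[of k] that by (cases "k = \<tau>") auto
    then have "X k = {0}" if "k \<in> {\<sigma><..\<tau>}" for k
      using X(1)[of k] that by blast
    moreover have "fresh Q X \<sigma> \<tau> \<inter> {..<1} = {0}"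
      using \<sigma>(2,3) 2(1,2) by (fastforce simp: fresh_def)
    ultimately show ?thesis
      using \<sigma> 2(1) by (intro exI[of _ \<sigma>] exI[of _ \<tau>]) auto
  qed
qed

lemma hard_graph_exists:
  "\<exists>par. hard (2 ^ l) (2 ^ l * (1 + 2 * l)) par \<and> well_formed (2 ^ l) (2 ^ l * (1 + 2 * l)) par"
proof (induction l)
  case 0
  have "hard 1 1 (\<lambda>_. []) \<and> well_formed 1 1 (\<lambda>_. [])"
    using hard_singleton by (simp add: well_formed_def)
  then show ?case by auto
next
  case (Suc l)
  then obtain par where par: "hard (2 ^ l) (2 ^ l * (1 + 2 * l)) par"
    "well_formed (2 ^ l) (2 ^ l * (1 + 2 * l)) par" by blast
  obtain A where A: "disperser (2 * 2 ^ l) (2 * 2 ^ l) A"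
    using disperser_exists[of "2 * 2 ^ l" "2 * 2 ^ l"] by auto
  obtain B where B: "disperser (2 * 2 ^ l) (2 ^ l) B"
    using disperser_exists[of "2 ^ l" "2 * 2 ^ l"] by auto
  have size: "2 ^ Suc l * (1 + 2 * Suc l) = 4 * 2 ^ l + 2 * (2 ^ l * (1 + 2 * l))"
    by (simp add: algebra_simps)
  show ?case
    using hard_stack[OF par _ A B] well_formed_stack[OF par(2) A B] unfolding size by auto
qed

section \<open>Legal pebblings and the expansion into paths\<close>

text \<open>Going back from \<open>k\<close> to the step that placed \<open>x\<close>, the parent
  carries a pebble one step earlier, hence strictly before \<open>k\<close>.\<close>

lemma legal_pebbling_parent:
  assumes "legal_pebbling V E P t" and "i \<le> k" "k \<le> t" and "x \<in> P k" "x \<notin> P i" and "(u, x) \<in> E"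
  shows "\<exists>k'\<in>{i..<k}. u \<in> P k'"
  using assms(2-5)
proof (induction k)
  case 0
  then show ?case by simp
next
  case (Suc k)
  have "i \<le> k" using Suc.prems by (metis le_Suc_eq)
  show ?case
  proof (cases "x \<in> P k")
    case True
    then show ?thesis using Suc \<open>i \<le> k\<close> by force
  next
    case False
    have "Suc k \<in> {1..t}" using Suc.prems by simp
    then have "\<forall>x \<in> P (Suc k) - P k. parents E x \<subseteq> P k"
      using assms(1) unfolding legal_pebbling_def by fastforce
    then have "u \<in> P k"
      using False Suc.prems(3) assms(6) unfolding parents_def by blast
    then show ?thesis using \<open>i \<le> k\<close> by auto
  qed
qed

text \<open>Completeness speaks of sinks only. Any other vertex has a child with a larger number,
  which is pebbled by induction and so forces a pebble on its parent.\<close>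

lemma complete_pebbling_covers:
  fixes n :: nat
  assumes "legal_pebbling {1..n} E P t" and "complete_pebbling {1..n} E P t"
    and E: "E \<subseteq> {1..n} \<times> {1..n}" "\<And>x y. (x, y) \<in> E \<Longrightarrow> x < y"
  shows "x \<in> {1..n} \<Longrightarrow> \<exists>k\<le>t. x \<in> P k"
proof (induction "n - x" arbitrary: x rule: less_induct)
  case less
  show ?case
  proof (cases "x \<in> sinks {1..n} E")
    case True
    then show ?thesis using assms(2) unfolding complete_pebbling_def by blast
  next
    case False
    then obtain y where y: "(x, y) \<in> E" using less.prems by (auto simp: sinks_def)
    then have "y \<in> {1..n}" "x < y" using E by auto
    moreover from this have "n - y < n - x" by (intro diff_less_mono2) auto
    ultimately obtain k where k: "k \<le> t" "y \<in> P k" using less.hyps[of y] by blast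
    have "y \<notin> P 0" using assms(1) by (simp add: legal_pebbling_def is_pebbling_def)
    then obtain k' where "k' \<in> {0..<k}" "x \<in> P k'"
      using legal_pebbling_parent[OF assms(1) _ k(1) k(2) _ y, of 0] by auto
    then show ?thesis using k(1) by (intro exI[of _ k']) auto
  qed
qed

text \<open>Vertex \<open>v\<close> becomes the path \<open>D * v + 1, \<dots>, D * v + D\<close>, whose \<open>l\<close>-th vertex receives the
  \<open>l\<close>-th parent of \<open>v\<close>; the vertices beyond \<open>D * M\<close> prolong the last path up to \<open>n\<close>.\<close>

definition path_expansion :: "nat \<Rightarrow> nat \<Rightarrow> nat \<Rightarrow> (nat \<Rightarrow> nat list) \<Rightarrow> (nat \<times> nat) set" where
  "path_expansion n D M par =
     {(x, Suc x) |x. 1 \<le> x \<and> x < n \<and> (D dvd x \<longrightarrow> D * M \<le> x)} \<union>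
     {(D * Suc (par v ! l), Suc (D * v + l)) |v l. v < M \<and> l < length (par v)}"

context
  fixes n D N M :: nat and par :: "nat \<Rightarrow> nat list"
  assumes D: "0 < D" and n: "D * M \<le> n" and N: "0 < N"
    and wf: "well_formed N M par" and len: "\<And>v. v < M \<Longrightarrow> length (par v) \<le> D"
begin

private abbreviation "E \<equiv> path_expansion n D M par"

lemma block_vertex_le: "v < M \<Longrightarrow> l < D \<Longrightarrow> Suc (D * v + l) \<le> D * M"
  using mult_le_mono2[of "Suc v" M D] by simp

lemma path_expansion_less: "(x, y) \<in> E \<Longrightarrow> x < y"
proof -
  have "D * Suc (par v ! l) < Suc (D * v + l)" if "v < M" "l < length (par v)" for v l
  proof -
    have "par v ! l < v" using wf that by (auto simp: well_formed_def)
    then have "D * Suc (par v ! l) \<le> D * v" by (intro mult_le_mono2) simp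
    then show ?thesis by simp
  qed
  then show "(x, y) \<in> E \<Longrightarrow> x < y" by (auto simp: path_expansion_def)
qed

lemma path_expansion_subset: "E \<subseteq> {1..n} \<times> {1..n}"
proof -
  have "Suc (D * v + l) \<le> n" if "v < M" "l < length (par v)" for v l
    using block_vertex_le[of v l] len[of v] n that by linarith
  then have "y \<le> n \<and> 1 \<le> x" if "(x, y) \<in> E" for x y
    using that D by (auto simp: path_expansion_def)
  then show ?thesis using path_expansion_less by fastforce
qed

lemma path_expansion_dag: "is_dag {1..n} E"
proof -
  have "E \<subseteq> less_than" using path_expansion_less by auto
  then have "acyclic E" by (meson wf_acyclic wf_less_than wf_subset)
  then show ?thesis using path_expansion_subset by (simp add: is_dag_def)
qed

text \<open>As \<open>l < D\<close>, a vertex determines its path and its position there, so it has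
  at most one parent besides its predecessor \<open>y - 1\<close>.\<close>

lemma path_expansion_indegree: "max_indeg_le {1..n} E 2"
  unfolding max_indeg_le_def
proof
  fix y
  have "parents E y \<subseteq> {y - 1, D * Suc (par ((y - 1) div D) ! ((y - 1) mod D))}"
  proof
    fix x assume "x \<in> parents E y"
    then consider "y = Suc x" | v l where "v < M" "l < length (par v)"
        "x = D * Suc (par v ! l)" "y = Suc (D * v + l)"
      by (auto simp: parents_def path_expansion_def)
    then show "x \<in> {y - 1, D * Suc (par ((y - 1) div D) ! ((y - 1) mod D))}"
    proof cases
      case 2
      then have "l < D" using len[of v] by simp
      then show ?thesis using 2 by simp
    qed simp
  qed
  then have "card (parents E y) \<le> card {y - 1, D * Suc (par ((y - 1) div D) ! ((y - 1) mod D))}"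
    by (rule card_mono[rotated]) simp
  also have "\<dots> \<le> 2" by (simp add: card_insert_if)
  finally show "card (parents E y) \<le> 2" .
qed

lemma path_edge: "v < M \<Longrightarrow> Suc l < D \<Longrightarrow> (Suc (D * v + l), Suc (D * v + Suc l)) \<in> E"
proof -
  assume v: "v < M" and l: "Suc l < D"
  have "\<not> D dvd Suc (D * v + l)"
    using l by (metis add_Suc_right dvd_add_right_iff dvd_triv_left nat_dvd_not_less zero_less_Suc)
  then show ?thesis
    using block_vertex_le[OF v l] n by (auto simp: path_expansion_def)
qed

lemma parent_edge: "v < M \<Longrightarrow> l < length (par v) \<Longrightarrow> (D * Suc (par v ! l), Suc (D * v + l)) \<in> E"
  by (auto simp: path_expansion_def)

text \<open>Inner path vertices and those beyond \<open>D * M\<close> have a path predecessor, and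
  the head of a non-input's path receives parent 0. What remains are the heads of the
  inputs.\<close>

lemma path_expansion_sources: "sources {1..n} E = (\<lambda>v. Suc (D * v)) ` {..<N}"
proof (intro equalityI subsetI)
  fix y assume y: "y \<in> sources {1..n} E"
  then have y': "1 \<le> y" "y \<le> n" "\<And>x. (x, y) \<notin> E" by (auto simp: sources_def parents_def)
  have "M > 0" using wf N by (auto simp: well_formed_def)
  have "y \<le> D * M"
  proof (rule ccontr)
    assume "\<not> y \<le> D * M"
    moreover have "0 < D * M" using D \<open>M > 0\<close> by simp
    ultimately have "1 \<le> y - 1" "y - 1 < n" "D * M \<le> y - 1" "Suc (y - 1) = y"
      using y' by linarith+
    then have "(y - 1, y) \<in> E"
      unfolding path_expansion_def by (intro UnI1 CollectI exI[of _ "y - 1"]) auto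
    with y' show False by blast
  qed
  define v l where "v = (y - 1) div D" and "l = (y - 1) mod D"
  have y_eq: "y = Suc (D * v + l)" using y' by (simp add: v_def l_def)
  have "l < D" using D by (simp add: l_def)
  have "v < M" using \<open>y \<le> D * M\<close> y' D by (simp add: v_def less_mult_imp_div_less mult.commute)
  have "l = 0"
  proof (rule ccontr)
    assume "l \<noteq> 0"
    then obtain l' where "l = Suc l'" by (cases l) auto
    with path_edge[OF \<open>v < M\<close>, of l'] \<open>l < D\<close> y' y_eq show False by auto
  qed
  moreover have "v < N"
  proof (rule ccontr)
    assume "\<not> v < N"
    then have "par v \<noteq> []" using wf \<open>v < M\<close> by (auto simp: well_formed_def)
    with parent_edge[OF \<open>v < M\<close>, of 0] y' y_eq \<open>l = 0\<close> show False by auto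
  qed
  ultimately show "y \<in> (\<lambda>v. Suc (D * v)) ` {..<N}" using y_eq by auto
next
  fix y assume "y \<in> (\<lambda>v. Suc (D * v)) ` {..<N}"
  then obtain v where v: "v < N" "y = Suc (D * v)" by auto
  have "v < M" "par v = []" using wf v by (auto simp: well_formed_def)
  have "(x, y) \<notin> E" for x
  proof
    assume "(x, y) \<in> E"
    then consider "x = D * v" "D dvd x \<longrightarrow> D * M \<le> x"
      | v' l' where "v' < M" "l' < length (par v')" "D * v = D * v' + l'"
      using v(2) by (auto simp: path_expansion_def)
    then show False
    proof cases
      case 1
      then show False using \<open>v < M\<close> D by auto
    next
      case 2
      have "l' < D" using 2 len[of v'] by simp
      then have "v = v'" using 2(3) D
        by (metis add.commute add.right_neutral div_less div_mult_self2 nonzero_mult_div_cancel_left not_gr_zero)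
      with 2 \<open>par v = []\<close> show False by simp
    qed
  qed
  moreover have "y \<le> n" using block_vertex_le[OF \<open>v < M\<close> D] n v(2) by simp
  ultimately show "y \<in> sources {1..n} E" using v(2) by (auto simp: sources_def parents_def)
qed

lemma card_path_expansion_sources: "card (sources {1..n} E) = N"
  unfolding path_expansion_sources using D by (simp add: card_image inj_on_def)

text \<open>Going back along the path from its completed end, each vertex must be pebbled after
  \<open>i\<close>. Position \<open>l\<close> then forces the \<open>l\<close>-th parent, and
  position 0 is the source if the path belongs to an input.\<close>

lemma legal_pebbling_path:
  assumes legal: "legal_pebbling {1..n} E P t" and v: "v < M"
    and untouched: "\<And>l. l < D \<Longrightarrow> Suc (D * v + l) \<notin> P i" and "i \<le> j" "j \<le> t" "D * Suc v \<in> P j"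
  shows "l < D \<Longrightarrow> \<exists>k\<in>{i<..j}. Suc (D * v + l) \<in> P k"
proof (induction "D - l" arbitrary: l rule: less_induct)
  case less
  have "\<exists>k\<in>{i..j}. Suc (D * v + l) \<in> P k"
  proof (cases "Suc l = D")
    case True
    then have "Suc (D * v + l) = D * Suc v" by simp
    then have "Suc (D * v + l) \<in> P j" using \<open>D * Suc v \<in> P j\<close> by (simp only:)
    then show ?thesis using \<open>i \<le> j\<close> by auto
  next
    case False
    then have l: "Suc l < D" using less.prems by simp
    then obtain k where k: "k \<in> {i<..j}" "Suc (D * v + Suc l) \<in> P k"
      using less.hyps[of "Suc l"] diff_less_mono2[of l "Suc l" D] by auto
    then show ?thesis
      using legal_pebbling_parent[OF legal _ _ k(2) untouched[OF l] path_edge[OF v l]] \<open>j \<le> t\<close> by force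
  qed
  then obtain k where "k \<in> {i..j}" "Suc (D * v + l) \<in> P k" by blast
  moreover have "k \<noteq> i" using calculation untouched[OF less.prems] by blast
  ultimately show ?case by force
qed

lemma pebbling_interval:
  assumes hard: "hard N M par"
    and legal: "legal_pebbling {1..n} E P t" and complete: "complete_pebbling {1..n} E P t"
  shows "\<exists>i j. 1 \<le> i \<and> i \<le> j \<and> j \<le> t \<and>
    N \<le> 2 * card (sources {1..n} E \<inter> ((\<Union>k\<in>{i..j}. P k) - P (i - 1))) \<and>
    (\<forall>k\<in>{i..j}. N \<le> 32 * card (P k))"
proof -
  \<comment> \<open>Since \<open>P\<close> is arbitrary beyond \<open>t\<close> while
    \<open>trace\<close> speaks of all times, both sets are made empty there.\<close>
  define Q where "Q = (\<lambda>k. {v. v < M \<and> k \<le> t \<and> D * Suc v \<in> P k})"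
  define X where "X = (\<lambda>k. {v. v < M \<and> k \<le> t \<and> (\<exists>l<D. Suc (D * v + l) \<in> P k)})"
  have P: "P 0 = {}" "\<And>k. k \<le> t \<Longrightarrow> P k \<subseteq> {1..n}"
    using legal by (auto simp: legal_pebbling_def is_pebbling_def)
  have finP: "finite (P k)" if "k \<le> t" for k
    using P(2)[OF that] finite_subset by blast
  have path: "\<exists>k\<in>{i<..j}. Suc (D * v + l) \<in> P k"
    if "i \<le> j" "v \<in> Q j" "v \<notin> X i" "l < D" for i j v l
    using that legal_pebbling_path[OF legal, of v i j l] by (auto simp: Q_def X_def)
  have tr: "trace M par Q X"
    unfolding trace_def
  proof (intro conjI allI impI)
    have last: "D * Suc v = Suc (D * v + (D - 1))" for v using D by simp
    show "Q k \<subseteq> X k" "X k \<subseteq> {..<M}" for k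
      using D unfolding Q_def X_def last by (auto intro!: exI[of _ "D - 1"])
  next
    fix i j v u assume *: "i \<le> j" "v \<in> Q j" "v \<notin> X i" "u \<in> set (par v)"
    then have v: "v < M" "j \<le> t" by (auto simp: Q_def)
    from *(4) obtain l where l: "l < length (par v)" "u = par v ! l"
      by (auto simp: in_set_conv_nth)
    then have "l < D" using len[OF v(1)] by simp
    then obtain k where k: "k \<in> {i<..j}" "Suc (D * v + l) \<in> P k"
      using path[OF *(1-3)] by blast
    have "Suc (D * v + l) \<notin> P i"
      using *(1,3) v \<open>l < D\<close> by (auto simp: X_def)
    then obtain k' where "k' \<in> {i..<k}" "D * Suc u \<in> P k'"
      using legal_pebbling_parent[OF legal _ _ k(2) _ parent_edge[OF v(1) l(1)], of i] k(1) v(2) l(2)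
      by auto
    moreover have "u < M"
      using wf v(1) *(4) by (auto simp: well_formed_def intro: less_trans)
    ultimately show "\<exists>k\<in>{i..j}. u \<in> Q k"
      using k(1) v(2) by (auto simp: Q_def intro!: bexI[of _ k'])
  qed
  \<comment> \<open>Nothing is touched at time 0 and every path end is pebbled eventually, so
    \<open>hard\<close> applies with \<open>s = 0\<close> and all outputs fresh.\<close>
  have "X 0 = {}" using P(1) by (auto simp: X_def)
  have "v \<in> fresh Q X 0 t" if "v < M" for v
  proof -
    have "D * Suc v \<le> D * M" using that by (intro mult_le_mono2) simp
    then have "D * Suc v \<in> {1..n}" using n D by auto
    then obtain k where k: "k \<le> t" "D * Suc v \<in> P k"
      using complete_pebbling_covers[OF legal complete path_expansion_subset path_expansion_less] by blast
    moreover have "k \<noteq> 0" using k(2) P(1) by (metis empty_iff)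
    ultimately show ?thesis using that \<open>X 0 = {}\<close> by (auto simp: fresh_def Q_def intro!: bexI[of _ k])
  qed
  then have "fresh Q X 0 t \<inter> {M - N..<M} = {M - N..<M}" by auto
  moreover have "N \<le> M" using wf by (simp add: well_formed_def)
  ultimately have "N \<le> 2 * card (fresh Q X 0 t \<inter> {M - N..<M})" by simp
  then obtain i j where ij: "i < j" "j \<le> t" "\<forall>k\<in>{i<..j}. N \<le> 32 * card (X k)"
    "N \<le> 2 * card (fresh Q X i j \<inter> {..<N})"
    using hard tr \<open>X 0 = {}\<close> unfolding hard_def by (metis card.empty mult_0_right zero_le)
  \<comment> \<open>Distinct touched paths contain distinct pebbles; the division recovers the path
    from a vertex.\<close>
  have card_X: "card (X k) \<le> card (P k)" if "k \<le> t" for k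
  proof -
    have "X k \<subseteq> (\<lambda>x. (x - 1) div D) ` P k"
    proof
      fix v assume "v \<in> X k"
      then obtain l where "l < D" "Suc (D * v + l) \<in> P k" by (auto simp: X_def)
      then show "v \<in> (\<lambda>x. (x - 1) div D) ` P k"
        by (intro image_eqI[where x = "Suc (D * v + l)"]) auto
    qed
    then show ?thesis by (metis card_image_le card_mono finP finite_imageI le_trans that)
  qed
  have "(\<lambda>v. Suc (D * v)) ` (fresh Q X i j \<inter> {..<N}) \<subseteq>
    sources {1..n} E \<inter> ((\<Union>k\<in>{Suc i..j}. P k) - P i)"
  proof
    fix y assume "y \<in> (\<lambda>v. Suc (D * v)) ` (fresh Q X i j \<inter> {..<N})"
    then obtain v where v: "v \<in> fresh Q X i j" "v < N" "y = Suc (D * v)" by auto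
    then obtain k where k: "k \<in> {i<..j}" "v \<in> Q k" "v \<notin> X i" by (auto simp: fresh_def)
    then obtain k' where "k' \<in> {i<..k}" "y \<in> P k'"
      using path[of i k v 0] D v(3) by auto
    moreover have "y \<notin> P i"
      using k ij(1,2) D v(3) by (auto simp: X_def Q_def)
    moreover have "y \<in> sources {1..n} E" unfolding path_expansion_sources using v by blast
    ultimately show "y \<in> sources {1..n} E \<inter> ((\<Union>k\<in>{Suc i..j}. P k) - P i)"
      using k(1) by (auto intro!: bexI[of _ k'])
  qed
  then have "card ((\<lambda>v. Suc (D * v)) ` (fresh Q X i j \<inter> {..<N})) \<le>
    card (sources {1..n} E \<inter> ((\<Union>k\<in>{Suc i..j}. P k) - P i))"
    unfolding path_expansion_sources by (rule card_mono[rotated]) simp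
  moreover have "card ((\<lambda>v. Suc (D * v)) ` (fresh Q X i j \<inter> {..<N})) = card (fresh Q X i j \<inter> {..<N})"
    using D by (intro card_image) (simp add: inj_on_def)
  \<comment> \<open>\<open>fresh\<close> counts from after \<open>i\<close>, so the closed interval
    starts at \<open>Suc i\<close>.\<close>
  ultimately have "N \<le> 2 * card (sources {1..n} E \<inter> ((\<Union>k\<in>{Suc i..j}. P k) - P (Suc i - 1)))"
    using ij(4) by simp
  moreover have "\<forall>k\<in>{Suc i..j}. N \<le> 32 * card (P k)"
  proof
    fix k assume k: "k \<in> {Suc i..j}"
    then have "N \<le> 32 * card (X k)" using ij(3) by auto
    also have "\<dots> \<le> 32 * card (P k)" using card_X[of k] k ij(2) by simp
    finally show "N \<le> 32 * card (P k)" .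
  qed
  ultimately show ?thesis
    using ij(1,2) by (intro exI[of _ "Suc i"] exI[of _ j]) auto
qed

end

section \<open>Choice of the level and the constants\<close>

lemma level_exists:
  fixes n :: nat
  assumes "256 \<le> n"
  obtains l where "256 * (2 ^ l * (1 + 2 * l)) \<le> n" "n < 256 * (2 ^ Suc l * (1 + 2 * Suc l))"
proof -
  let ?f = "\<lambda>l::nat. 256 * (2 ^ l * (1 + 2 * l))"
  have "n < ?f n"
  proof -
    have "n < 2 ^ n" by simp
    also have "\<dots> \<le> ?f n" by simp
    finally show ?thesis .
  qed
  then obtain m where m: "n < ?f m" "\<And>l. l < m \<Longrightarrow> \<not> n < ?f l"
    using exists_least_iff[of "\<lambda>l. n < ?f l"] by blast
  with assms obtain l where "m = Suc l" by (cases m) auto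
  with m show thesis by (intro that[of l]) (auto simp: not_less)
qed

text \<open>Here \<open>log 2 n\<close> lies between \<open>8 + l\<close> and
  \<open>11 + 3 * l\<close>, so dividing \<open>n\<close> by it cancels the factor
  \<open>1 + 2 * l\<close> up to constants.\<close>

lemma level_bounds:
  fixes n l :: nat
  assumes lower: "256 * (2 ^ l * (1 + 2 * l)) \<le> n" and upper: "n < 256 * (2 ^ Suc l * (1 + 2 * Suc l))"
  shows "2 ^ l \<le> real n / log 2 (real n)" and "real n / log 2 (real n) \<le> 1024 * 2 ^ l"
proof -
  have le: "256 * (2 ^ l * (1 + 2 * real l)) \<le> real n"
    using of_nat_mono[OF lower, where 'a = real] by (simp add: algebra_simps)
  have "n < 256 * (2 ^ Suc l * 2 ^ Suc (Suc (2 * l)))"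
  proof -
    have "1 + 2 * Suc l \<le> 2 ^ Suc (Suc (2 * l))"
      by (induction l) auto
    then have "256 * (2 ^ Suc l * (1 + 2 * Suc l)) \<le> 256 * (2 ^ Suc l * 2 ^ Suc (Suc (2 * l)))"
      by (intro mult_le_mono2)
    with upper show ?thesis by (rule order.strict_trans2)
  qed
  also have "\<dots> = 2 ^ (8 + (Suc l + Suc (Suc (2 * l))))"
    unfolding power_add by simp
  also have "8 + (Suc l + Suc (Suc (2 * l))) = 11 + 3 * l" by simp
  finally have "real n < 2 ^ (11 + 3 * l)" by (simp flip: of_nat_less_iff)
  moreover have "0 < n" using lower by (cases n) auto
  ultimately have "log 2 (real n) < log 2 (2 ^ (11 + 3 * l))"
    by (subst log_less_cancel_iff) auto
  then have log_le: "log 2 (real n) \<le> 11 + 3 * real l" by simp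
  have "2 ^ (8 + l) \<le> real n"
    using le order_trans[OF mult_left_mono[of 1 "1 + 2 * real l" "256 * 2 ^ l"]] by (simp add: power_add mult.assoc)
  then have "log 2 (2 ^ (8 + l)) \<le> log 2 (real n)"
    using \<open>0 < n\<close> by (subst log_le_cancel_iff) auto
  then have log_ge: "8 + real l \<le> log 2 (real n)" by simp
  have "2 ^ l * log 2 (real n) \<le> 2 ^ l * (256 * (1 + 2 * real l))"
    using log_le by (intro mult_left_mono) auto
  then show "2 ^ l \<le> real n / log 2 (real n)"
    using le log_ge by (subst pos_le_divide_eq) (auto simp: algebra_simps)
  have "real n \<le> 256 * (2 ^ Suc l * (1 + 2 * real (Suc l)))"
    using of_nat_mono[OF less_imp_le[OF upper], where 'a = real] by (simp add: algebra_simps)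
  also have "\<dots> \<le> 1024 * 2 ^ l * (8 + real l)" by (simp add: algebra_simps)
  also have "\<dots> \<le> 1024 * 2 ^ l * log 2 (real n)" using log_ge by (intro mult_left_mono) auto
  finally show "real n / log 2 (real n) \<le> 1024 * 2 ^ l"
    using log_ge by (subst pos_divide_le_eq) auto
qed

lemma hard_digraph_exists:
  fixes n :: nat
  assumes "2 \<le> n"
  shows "\<exists>E. is_dag {1..n} E \<and> max_indeg_le {1..n} E 2 \<and>
    real (card (sources {1..n} E)) \<le> real n / log 2 (real n) \<and>
    real n / log 2 (real n) \<le> 1024 * real (card (sources {1..n} E)) \<and>
    (\<forall>P t. legal_pebbling {1..n} E P t \<longrightarrow> complete_pebbling {1..n} E P t \<longrightarrow>
      (\<exists>i j. 1 \<le> i \<and> i \<le> j \<and> j \<le> t \<and>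
        card (sources {1..n} E) \<le> 2 * card (sources {1..n} E \<inter> ((\<Union>k\<in>{i..j}. P k) - P (i - 1))) \<and>
        (\<forall>k\<in>{i..j}. card (sources {1..n} E) \<le> 32 * card (P k))))"
proof -
  obtain D N M par where *: "0 < D" "D * M \<le> n" "0 < N" "well_formed N M par"
    "\<And>v. v < M \<Longrightarrow> length (par v) \<le> D" "hard N M par"
    "real N \<le> real n / log 2 (real n)" "real n / log 2 (real n) \<le> 1024 * real N"
  proof (cases "256 \<le> n")
    case True
    then obtain l where l: "256 * (2 ^ l * (1 + 2 * l)) \<le> n" "n < 256 * (2 ^ Suc l * (1 + 2 * Suc l))"
      by (rule level_exists)
    obtain par where par: "hard (2 ^ l) (2 ^ l * (1 + 2 * l)) par" "well_formed (2 ^ l) (2 ^ l * (1 + 2 * l)) par"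
      using hard_graph_exists by blast
    \<comment> \<open>Paths of length 256 accommodate every list allowed by
      \<open>well_formed\<close>.\<close>
    show thesis
      using l par level_bounds[OF l]
      by (intro that[of 256 "2 ^ l * (1 + 2 * l)" "2 ^ l" par]) (auto simp: well_formed_def)
  next
    \<comment> \<open>For small \<open>n\<close> a single path with one source suffices, as
      \<open>n / log 2 n\<close> lies between 1 and 1024.\<close>
    case False
    have log_pos: "1 \<le> log 2 (real n)" using assms by (simp add: le_log_iff)
    have "log 2 (real n) \<le> log 2 (2 ^ n)"
      using assms less_imp_le[OF of_nat_less_two_power[of n, where 'a = real]]
      by (subst log_le_cancel_iff) auto
    then have "1 \<le> real n / log 2 (real n)" using log_pos assms by (simp add: le_divide_eq)
    moreover have "real n / log 2 (real n) \<le> 1024"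
    proof -
      have "real n / log 2 (real n) \<le> real n / 1" using log_pos by (intro divide_left_mono) auto
      then show ?thesis using False by simp
    qed
    ultimately show thesis
      using assms hard_singleton by (intro that[of 1 1 1 "\<lambda>_. []"]) (auto simp: well_formed_def)
  qed
  show ?thesis
  proof (intro exI[of _ "path_expansion n D M par"] conjI allI impI)
    show "is_dag {1..n} (path_expansion n D M par)"
      by (rule path_expansion_dag[OF *(1-5)])
    show "max_indeg_le {1..n} (path_expansion n D M par) 2"
      by (rule path_expansion_indegree[OF *(1-5)])
  qed (use *(7,8) pebbling_interval[OF *(1-6)] card_path_expansion_sources[OF *(1-5)] in \<open>simp_all only:\<close>)
qed

theorem mainTheorem4:
  shows "\<exists>(c1::real) (c2::real) (c3::real) (G :: nat \<Rightarrow> (nat \<times> nat) set).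
    c1 > 0 \<and> c2 > 0 \<and> c3 > 0 \<and>
    (\<forall>n\<ge>2. is_dag {1..n} (G n) \<and> max_indeg_le {1..n} (G n) 2 \<and>
       real (card (sources {1..n} (G n))) \<le> c1 * real n / log 2 (real n) \<and>
       (\<forall>P t. legal_pebbling {1..n} (G n) P t \<and> complete_pebbling {1..n} (G n) P t \<longrightarrow>
          (\<exists>i j. 1 \<le> i \<and> i \<le> j \<and> j \<le> t \<and>
             real (card (sources {1..n} (G n) \<inter> ((\<Union>k\<in>{i..j}. P k) - P (i - 1))))
               \<ge> c2 * real n / log 2 (real n) \<and>
             (\<forall>k\<in>{i..j}. real (card (P k)) \<ge> c3 * real n / log 2 (real n)))))"
proof -
  let ?N = "\<lambda>n E. card (sources {1..n} E)"
  define good where "good = (\<lambda>(n::nat) E. is_dag {1..n} E \<and> max_indeg_le {1..n} E 2 \<and>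
    real (?N n E) \<le> real n / log 2 (real n) \<and> real n / log 2 (real n) \<le> 1024 * real (?N n E) \<and>
    (\<forall>P t. legal_pebbling {1..n} E P t \<longrightarrow> complete_pebbling {1..n} E P t \<longrightarrow>
      (\<exists>i j. 1 \<le> i \<and> i \<le> j \<and> j \<le> t \<and>
        ?N n E \<le> 2 * card (sources {1..n} E \<inter> ((\<Union>k\<in>{i..j}. P k) - P (i - 1))) \<and>
        (\<forall>k\<in>{i..j}. ?N n E \<le> 32 * card (P k)))))"
  have "\<forall>n. \<exists>E. 2 \<le> n \<longrightarrow> good n E"
    using hard_digraph_exists unfolding good_def by simp
  from choice[OF this] obtain G where "\<forall>n. 2 \<le> n \<longrightarrow> good n (G n)" by blast
  then have G: "good n (G n)" if "2 \<le> n" for n using that by blast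
  have scale: "1 / (1024 * real m) * real n / log 2 (real n) \<le> real a"
    if "real n / log 2 (real n) \<le> 1024 * real (?N n (G n))" "?N n (G n) \<le> m * a" "0 < m" for n m a
  proof -
    have "real n / log 2 (real n) \<le> 1024 * (real m * real a)"
      using that(1,2) by (metis (mono_tags) mult_left_mono of_nat_le_iff of_nat_mult order_trans zero_le_numeral)
    then have "real n / log 2 (real n) / (1024 * real m) \<le> real a"
      using that(3) by (subst pos_divide_le_eq) (auto simp: mult.commute mult.left_commute)
    then show ?thesis by (simp add: mult.commute)
  qed
  show ?thesis
  \<comment> \<open>The factor 1024 compares \<open>n / log 2 n\<close> with the number of sources;
    2 and 32 come from \<open>hard\<close>.\<close>
  proof (rule exI[of _ 1], rule exI[of _ "1 / (1024 * real 2)"], rule exI[of _ "1 / (1024 * real 32)"],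
      rule exI[of _ G], intro conjI allI impI)
    fix n P t assume n: "2 \<le> n"
      and "legal_pebbling {1..n} (G n) P t \<and> complete_pebbling {1..n} (G n) P t"
    then obtain i j where ij: "1 \<le> i" "i \<le> j" "j \<le> t"
      "?N n (G n) \<le> 2 * card (sources {1..n} (G n) \<inter> ((\<Union>k\<in>{i..j}. P k) - P (i - 1)))"
      "\<forall>k\<in>{i..j}. ?N n (G n) \<le> 32 * card (P k)"
      using G[OF n] unfolding good_def by blast
    have bound: "real n / log 2 (real n) \<le> 1024 * real (?N n (G n))" using G[OF n] unfolding good_def by blast
    show "\<exists>i j. 1 \<le> i \<and> i \<le> j \<and> j \<le> t \<and>
       1 / (1024 * real 2) * real n / log 2 (real n)
         \<le> real (card (sources {1..n} (G n) \<inter> ((\<Union>k\<in>{i..j}. P k) - P (i - 1)))) \<and>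
       (\<forall>k\<in>{i..j}. 1 / (1024 * real 32) * real n / log 2 (real n) \<le> real (card (P k)))"
      using ij scale[OF bound ij(4)] scale[OF bound, of 32]
      by (intro exI[of _ i] exI[of _ j]) auto
  qed (use G in \<open>auto simp: good_def\<close>)
qed

end
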